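(* The function $F:[0,1]^2\to\mathbb{R}$, $$F(x,y)=\int_0^x\int_0^y s\oplus t\,ds\,dt-\frac14\int_0^x\int_0^x s\oplus t\,ds\,dt-\frac14\int_0^y\int_0^y s\oplus t\,ds\,dt,$$ solves the problem $$\int_{[0,1]^2}F(x,y)\,dx\,dy+\int_{[0,1]^2}F(x,z)\,dx\,dz+\int_{[0,1]^2}F(y,z)\,dy\,dz\to\max,$$ $$F(x,y)+F(x,z)+F(y,z)\le xyz,$$ which is the dual of the primal problem of minimizing $\int xyz\,d\pi$ over Borel probability measures $\pi$ on $[0,1]^3$ whose projections onto the three coordinate planes are Lebesgue measure on $[0,1]^2$. That is, $F(x,y)+F(x,z)+F(y,z)\le xyz$ for all $x,y,z\in[0,1]$, and $F$ maximizes the functional $G\mapsto\int_{[0,1]^2}G(x,y)\,dx\,dy+\int_{[0,1]^2}G(x,z)\,dx\,dz+\int_{[0,1]^2}G(y,z)\,dy\,dz$ among all Lebesgue integrable functions $G$ on $[0,1]^2$ satisfying $G(x,y)+G(x,z)+G(y,z)\le xyz$ for all $x,y,z\in[0,1]$.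
   Context: Bitwise addition (xor): for $x,y\in[0,1]$ with binary expansions $x=\sum_{i\ge1}x_i2^{-i}$, $y=\sum_{i\ge1}y_i2^{-i}$, $x_i,y_i\in\{0,1\}$, one sets $x\oplus y=\sum_{i\ge1}\big((x_i+y_i)\bmod 2\big)2^{-i}$. Convention: every dyadic rational number less than $1$ is written with finitely many digits equal to $1$, and $1$ is written as $0.1111\ldots$. *)

theory Defs
  imports "HOL-Analysis.Analysis"
begin

text \<open>
  The \<open>i\<close>-th binary digit (\<open>i \<ge> 1\<close>) of \<open>x \<in> [0,1]\<close>.  The floor formula selects the
  finite expansion of every dyadic rational below \<open>1\<close>, while \<open>1\<close> is written as
  \<open>0.1111...\<close>; the three lemmas after the definition confirm that this is a binary
  expansion with the stated convention.
\<close>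

definition bin_digit :: "real \<Rightarrow> nat \<Rightarrow> nat" where
  "bin_digit x i = (if x = 1 then 1 else nat \<lfloor>x * 2 ^ i\<rfloor> mod 2)"

lemma bin_digit_01: "bin_digit x i \<in> {0, 1}"
  by (auto simp: bin_digit_def)

lemma bin_digit_sums:
  assumes "x \<in> {0..1}"
  shows "(\<lambda>i. real (bin_digit x (Suc i)) / 2 ^ Suc i) sums x"
proof (cases "x = 1")
  case True
  then show ?thesis
    using power_half_series by (simp add: bin_digit_def power_one_over)
next
  case False
  with assms have x: "0 \<le> x" "x < 1" by auto
  have step: "real (bin_digit x (Suc n)) = of_int \<lfloor>x * 2 ^ Suc n\<rfloor> - 2 * of_int \<lfloor>x * 2 ^ n\<rfloor>" for n
  proof -
    have "\<lfloor>x * 2 ^ n\<rfloor> = \<lfloor>x * 2 ^ Suc n\<rfloor> div 2"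
      using floor_divide_real_eq_div[of 2 "x * 2 ^ Suc n"] by simp
    moreover have "int (bin_digit x (Suc n)) = \<lfloor>x * 2 ^ Suc n\<rfloor> mod 2"
      using x False by (simp add: bin_digit_def zmod_int)
    ultimately have "int (bin_digit x (Suc n)) = \<lfloor>x * 2 ^ Suc n\<rfloor> - 2 * \<lfloor>x * 2 ^ n\<rfloor>"
      by presburger
    then have "real_of_int (int (bin_digit x (Suc n))) = of_int (\<lfloor>x * 2 ^ Suc n\<rfloor> - 2 * \<lfloor>x * 2 ^ n\<rfloor>)"
      by (simp only:)
    then show ?thesis by simp
  qed
  have part: "(\<Sum>i<n. real (bin_digit x (Suc i)) / 2 ^ Suc i) = of_int \<lfloor>x * 2 ^ n\<rfloor> / 2 ^ n" for n
  proof (induction n)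
    case 0
    have "\<lfloor>x\<rfloor> = 0" using x by (simp add: floor_eq_iff)
    then show ?case by simp
  next
    case (Suc n)
    show ?case
      unfolding sum.lessThan_Suc Suc.IH by (simp add: step field_simps)
  qed
  have "(\<lambda>n. of_int \<lfloor>x * 2 ^ n\<rfloor> / 2 ^ n) \<longlonglongrightarrow> x"
  proof (rule real_tendsto_sandwich)
    have "(\<lambda>n. x - (1/2) ^ n) \<longlonglongrightarrow> x - 0"
      by (intro tendsto_intros LIMSEQ_power_zero) simp
    then show "(\<lambda>n. x - (1/2) ^ n) \<longlonglongrightarrow> x" by simp
    show "\<forall>\<^sub>F n in sequentially. x - (1/2) ^ n \<le> of_int \<lfloor>x * 2 ^ n\<rfloor> / 2 ^ n"
    proof (intro always_eventually allI)
      fix n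
      have "x * 2 ^ n - 1 \<le> of_int \<lfloor>x * 2 ^ n\<rfloor>" by linarith
      then have "(x * 2 ^ n - 1) / 2 ^ n \<le> of_int \<lfloor>x * 2 ^ n\<rfloor> / 2 ^ n"
        by (rule divide_right_mono) simp
      then show "x - (1/2) ^ n \<le> of_int \<lfloor>x * 2 ^ n\<rfloor> / 2 ^ n"
        by (simp add: diff_divide_distrib power_one_over)
    qed
    show "\<forall>\<^sub>F n in sequentially. of_int \<lfloor>x * 2 ^ n\<rfloor> / 2 ^ n \<le> x"
      by (intro always_eventually allI) (simp add: field_simps)
  qed simp
  then show ?thesis unfolding sums_def part .
qed

lemma bin_digit_dyadic_finite:
  assumes "x = real k / 2 ^ m" and "x < 1"
  shows "finite {i. bin_digit x i = 1}"
proof (rule finite_subset)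
  show "{i. bin_digit x i = 1} \<subseteq> {..m}"
  proof
    fix i assume i: "i \<in> {i. bin_digit x i = 1}"
    show "i \<in> {..m}"
    proof (rule ccontr)
      assume "i \<notin> {..m}"
      then obtain j where j: "i = m + Suc j"
        by (metis atMost_iff less_iff_Suc_add not_le add_Suc_right)
      have "x * 2 ^ i = real (k * 2 ^ Suc j)"
        using assms(1) by (simp add: j power_add)
      then have "nat \<lfloor>x * 2 ^ i\<rfloor> = k * 2 ^ Suc j" by (metis floor_of_nat nat_int)
      then have "bin_digit x i = 0" using assms(2) by (simp add: bin_digit_def)
      then show False using i by simp
    qed
  qed
qed simp

definition binxor :: "real \<Rightarrow> real \<Rightarrow> real" where
  "binxor x y = (\<Sum>i. real ((bin_digit x (Suc i) + bin_digit y (Suc i)) mod 2) / 2 ^ Suc i)"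

definition xor_F :: "real \<Rightarrow> real \<Rightarrow> real" where
  "xor_F x y =
     (LBINT t=0..x. (LBINT s=0..y. binxor s t))
     - 1/4 * (LBINT t=0..x. (LBINT s=0..x. binxor s t))
     - 1/4 * (LBINT t=0..y. (LBINT s=0..y. binxor s t))"

definition dual_feasible :: "(real \<Rightarrow> real \<Rightarrow> real) \<Rightarrow> bool" where
  "dual_feasible G \<longleftrightarrow>
     set_integrable lebesgue ({0..1} \<times> {0..1}) (\<lambda>(x, y). G x y) \<and>
     (\<forall>x\<in>{0..1}. \<forall>y\<in>{0..1}. \<forall>z\<in>{0..1}. G x y + G x z + G y z \<le> x * y * z)"

definition dual_objective :: "(real \<Rightarrow> real \<Rightarrow> real) \<Rightarrow> real" where
  "dual_objective G =
     (LINT (x, y):{0..1} \<times> {0..1}|lebesgue. G x y)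
     + (LINT (x, z):{0..1} \<times> {0..1}|lebesgue. G x z)
     + (LINT (y, z):{0..1} \<times> {0..1}|lebesgue. G y z)"

end

theory Submission
  imports Defs
begin

text \<open>
  Write \<open>X x y\<close> for the integral of \<open>s \<oplus> t\<close> over \<open>[0,x] \<times> [0,y]\<close> and \<open>\<Phi>\<close> for \<open>xyz\<close> minus
  \<open>F(x,y) + F(x,z) + F(y,z)\<close>.  Splitting off the first binary digit expresses \<open>X\<close> through
  itself at scale \<open>1/8\<close>.  If the first digits of \<open>x, y, z\<close> have even sum, \<open>\<Phi>\<close> is exactly \<open>1/8\<close>
  of its value at the shifted point; if the sum is odd, a quadratic correction \<open>Q\<close> appears, up
  to reflecting two coordinates.  Both \<open>\<Phi>\<close> and \<open>\<Phi> + Q\<close> are bounded below by \<open>1/8\<close> of one of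
  these two functions at another point, so any common lower bound \<open>-m\<close> improves to \<open>-m/8\<close>, and
  both are nonnegative.

  For optimality, let \<open>\<pi>\<^sub>n\<close> be the uniform probability measure on the triples whose first \<open>n\<close>
  digits all have even sum.  Its three coordinate projections are uniform on the square, and
  \<open>\<Phi> \<le> 6 / 8 ^ n\<close> on its support.  Integrating the constraint against \<open>\<pi>\<^sub>n\<close> bounds the objective
  of any feasible \<open>G\<close> by that of \<open>F\<close> plus \<open>6 / 8 ^ n\<close>.  Using the absolutely continuous
  measures \<open>\<pi>\<^sub>n\<close> instead of the optimal measure carried by \<open>z = x \<oplus> y\<close> reduces the marginal
  computation to Fubini.
\<close>

section \<open>Self-similarity of the xor and of its integrals\<close>

lemma binxor_term_le:
  "real ((bin_digit x i + bin_digit y i) mod 2) / 2 ^ i \<le> (1/2) ^ i"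
  by (simp add: power_divide divide_right_mono)

lemma binxor_summable:
  "summable (\<lambda>i. real ((bin_digit x (Suc i) + bin_digit y (Suc i)) mod 2) / 2 ^ Suc i)"
proof (rule summable_comparison_test')
  show "summable (\<lambda>i. (1/2 :: real) ^ Suc i)"
    using power_half_series by (rule sums_summable)
  show "norm (real ((bin_digit x (Suc n) + bin_digit y (Suc n)) mod 2) / 2 ^ Suc n) \<le> (1/2) ^ Suc n" for n
    using binxor_term_le[of x "Suc n" y] by simp
qed

lemma binxor_nonneg: "0 \<le> binxor x y"
  unfolding binxor_def by (intro suminf_nonneg binxor_summable) simp

lemma binxor_le_1: "binxor x y \<le> 1"
proof -
  have "binxor x y \<le> (\<Sum>i. (1/2 :: real) ^ Suc i)"
    unfolding binxor_def
    using power_half_series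
    by (intro suminf_le binxor_summable binxor_term_le) (auto simp: sums_iff)
  then show ?thesis using power_half_series by (simp add: sums_iff)
qed

text \<open>Adding \<open>d\<close> and halving prefixes the digit \<open>d\<close> to the expansion
  of \<open>s\<close>. The value \<open>s = 1\<close> is excluded: its digits are all 1, whereas 1/2
  is written 0.1000..., so prefixing 0 would give the wrong digits.\<close>

lemma bin_digit_shift:
  assumes "0 \<le> s" "s < 1" "d \<le> 1"
  shows "bin_digit ((real d + s) / 2) (Suc 0) = d"
    and "bin_digit ((real d + s) / 2) (Suc (Suc i)) = bin_digit s (Suc i)"
proof -
  have ne: "(real d + s) / 2 \<noteq> 1" "s \<noteq> 1" using assms by auto
  have "\<lfloor>real d + s\<rfloor> = int d" using assms by (simp add: floor_eq_iff)
  moreover have "(real d + s) / 2 * 2 ^ Suc 0 = real d + s" by simp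
  ultimately have "nat \<lfloor>(real d + s) / 2 * 2 ^ Suc 0\<rfloor> = d" by (simp only: nat_int)
  moreover have "d mod 2 = d" using assms(3) by simp
  ultimately show "bin_digit ((real d + s) / 2) (Suc 0) = d"
    unfolding bin_digit_def using ne(1) by (simp only: if_False)
  have "(real d + s) / 2 * 2 ^ Suc (Suc i) = of_int (int (d * 2 ^ Suc i)) + s * 2 ^ Suc i"
    by (simp add: field_simps)
  then have "\<lfloor>(real d + s) / 2 * 2 ^ Suc (Suc i)\<rfloor> = int (d * 2 ^ Suc i) + \<lfloor>s * 2 ^ Suc i\<rfloor>"
    by (simp only: int_add_floor)
  moreover have "0 \<le> \<lfloor>s * 2 ^ Suc i\<rfloor>" using assms by simp
  ultimately have "nat \<lfloor>(real d + s) / 2 * 2 ^ Suc (Suc i)\<rfloor> = d * 2 ^ Suc i + nat \<lfloor>s * 2 ^ Suc i\<rfloor>"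
    by (simp only: nat_add_distrib of_nat_0_le_iff nat_int)
  moreover have "(d * 2 ^ Suc i + n) mod 2 = n mod 2" for n :: nat
    by (simp add: mult.left_commute[of d 2])
  ultimately show "bin_digit ((real d + s) / 2) (Suc (Suc i)) = bin_digit s (Suc i)"
    unfolding bin_digit_def using ne by (simp only: if_False)
qed

lemma binxor_shift:
  assumes "0 \<le> s" "s < 1" "d \<le> 1" "0 \<le> t" "t < 1" "e \<le> 1"
  shows "binxor ((real d + s) / 2) ((real e + t) / 2) = real ((d + e) mod 2) / 2 + binxor s t / 2"
proof -
  let ?f = "\<lambda>x y i. real ((bin_digit x (Suc i) + bin_digit y (Suc i)) mod 2) / 2 ^ Suc i"
  let ?x = "(real d + s) / 2" and ?y = "(real e + t) / 2"
  have "?f ?x ?y (Suc i) = ?f s t i / 2" for i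
    using assms by (simp add: bin_digit_shift)
  then have "(\<Sum>i. ?f ?x ?y (Suc i)) = binxor s t / 2"
    unfolding binxor_def using suminf_divide[OF binxor_summable[of s t], of 2] by presburger
  moreover have "?f ?x ?y 0 = real ((d + e) mod 2) / 2"
    using assms by (simp add: bin_digit_shift)
  ultimately show ?thesis
    using suminf_split_head[OF binxor_summable[of ?x ?y]] unfolding binxor_def by argo
qed

section \<open>Measurability of the xor and interval integrals under halving\<close>

lemma measurable_bin_digit [measurable]:
  "(\<lambda>x. bin_digit x i) \<in> measurable borel (count_space UNIV)"
  unfolding bin_digit_def by measurable

lemma borel_measurable_binxor [measurable]:
  assumes [measurable]: "f \<in> borel_measurable M" "g \<in> borel_measurable M"
  shows "(\<lambda>x. binxor (f x) (g x)) \<in> borel_measurable M"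
  unfolding binxor_def by measurable

lemma interval_integrable_bounded:
  fixes f :: "real \<Rightarrow> real"
  assumes [measurable]: "f \<in> borel_measurable borel" and B: "\<And>x. \<bar>f x\<bar> \<le> B"
  shows "interval_lebesgue_integrable lborel (ereal a) (ereal b) f"
proof -
  have "set_integrable lborel {a<..<b} f" for a b
  proof -
    have "emeasure lborel {a<..<b} < \<infinity>" by (rule emeasure_bounded_finite) simp
    then show ?thesis
      unfolding set_integrable_def
      by (intro integrableI_bounded_set_indicator[where B = B]) (use B in auto)
  qed
  then show ?thesis by (simp add: interval_lebesgue_integrable_def)
qed

lemma interval_integral_affine:
  fixes f :: "real \<Rightarrow> real"
  assumes "0 \<le> b"
  shows "(LBINT s=ereal (d/2)..ereal ((d + b) / 2). f s) = (LBINT u=0..ereal b. f ((d + u) / 2)) / 2"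
proof -
  have "(LBINT s=ereal (d/2)..ereal ((d + b) / 2). f s) = (LINT s|lborel. indicator {d/2<..<(d+b)/2} s * f s)"
    using assms by (simp add: interval_lebesgue_integral_def set_lebesgue_integral_def divide_right_mono)
  also have "\<dots> = (LINT u|lborel. indicator {d/2<..<(d+b)/2} (d/2 + 1/2 * u) * f (d/2 + 1/2 * u)) / 2"
    by (subst lborel_integral_real_affine[where c = "1/2" and t = "d/2"]) auto
  also have "\<dots> = (LINT u|lborel. indicator {0<..<b} u * f ((d + u) / 2)) / 2"
  proof -
    have "indicator {d/2<..<(d+b)/2} (d/2 + 1/2 * u) * f (d/2 + 1/2 * u)
        = indicator {0<..<b} u * f ((d + u) / 2)" for u
      by (simp add: add_divide_distrib indicator_def)
    then show ?thesis by (simp only:)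
  qed
  also have "\<dots> = (LBINT u=0..ereal b. f ((d + u) / 2)) / 2"
    using assms by (simp add: interval_lebesgue_integral_def set_lebesgue_integral_def zero_ereal_def)
  finally show ?thesis .
qed

lemma interval_integral_halves:
  fixes f :: "real \<Rightarrow> real"
  assumes "f \<in> borel_measurable borel" and "\<And>x. \<bar>f x\<bar> \<le> B" and "0 \<le> b"
  shows "(LBINT s=0..ereal (b/2). f s) = (LBINT u=0..ereal b. f (u / 2)) / 2"
    and "(LBINT s=0..ereal ((1 + b) / 2). f s) = (LBINT u=0..ereal 1. f (u / 2)) / 2 + (LBINT u=0..ereal b. f ((1 + u) / 2)) / 2"
proof -
  have half: "(LBINT s=0..ereal (b/2). f s) = (LBINT u=0..ereal b. f (u / 2)) / 2" if "0 \<le> b" for b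
    using interval_integral_affine[OF that, of 0 f] by (simp add: zero_ereal_def)
  then show "(LBINT s=0..ereal (b/2). f s) = (LBINT u=0..ereal b. f (u / 2)) / 2"
    using assms(3) .
  show "(LBINT s=0..ereal ((1 + b) / 2). f s) = (LBINT u=0..ereal 1. f (u / 2)) / 2 + (LBINT u=0..ereal b. f ((1 + u) / 2)) / 2"
    using interval_integral_sum[of 0 "ereal (1/2)" "ereal ((1 + b) / 2)" f]
      interval_integrable_bounded[OF assms(1,2), of 0 "(1+b)/2"]
      half[of 1] interval_integral_affine[OF assms(3), of 1 f] assms(3)
    by (simp add: zero_ereal_def min_def max_def)
qed

text \<open>An interval integral does not see its endpoints, so the relation between
  \<open>f\<close> and \<open>g\<close> is only asked for on \<open>[0,1)\<close>, where
  \<open>binxor_shift\<close> is available.\<close>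

lemma interval_integral_affine_cong:
  fixes f g :: "real \<Rightarrow> real"
  assumes "g \<in> borel_measurable borel" and "\<And>x. \<bar>g x\<bar> \<le> B" and "0 \<le> b" "b \<le> 1"
    and eq: "\<And>x. 0 \<le> x \<Longrightarrow> x < 1 \<Longrightarrow> f x = c + k * g x"
  shows "(LBINT s=0..ereal b. f s) = c * b + k * (LBINT s=0..ereal b. g s)"
proof -
  have "(LBINT s=0..ereal b. f s) = (LBINT s=0..ereal b. c + k * g s)"
    using assms(3,4) by (intro interval_integral_cong) (auto simp: eq zero_ereal_def min_def)
  also have "\<dots> = c * b + k * (LBINT s=0..ereal b. g s)"
    using interval_integrable_bounded[OF assms(1,2), of 0 b] assms(3)
    by (subst interval_lebesgue_integral_add) (auto simp: zero_ereal_def)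
  finally show ?thesis .
qed

lemma interval_integral_abs_le:
  fixes f :: "real \<Rightarrow> real"
  assumes [measurable]: "f \<in> borel_measurable borel" and B: "\<And>x. \<bar>f x\<bar> \<le> B" and b: "0 \<le> b"
  shows "\<bar>LBINT s=0..ereal b. f s\<bar> \<le> B * b"
proof -
  have "norm (LINT s|lborel. indicator {0<..<b} s *\<^sub>R f s) \<le> (LINT s|lborel. indicator {0<..<b} s *\<^sub>R B)"
  proof (rule Bochner_Integration.integral_norm_bound_integral)
    show "integrable lborel (\<lambda>s. indicator {0<..<b} s *\<^sub>R f s)"
      using interval_integrable_bounded[OF assms(1,2), of 0 b] b
      by (simp add: interval_lebesgue_integrable_def set_integrable_def)
    show "integrable lborel (\<lambda>s. indicator {0<..<b} s *\<^sub>R B)"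
      using interval_integrable_bounded[of "\<lambda>_. B" "\<bar>B\<bar>" 0 b] b
      by (simp add: interval_lebesgue_integrable_def set_integrable_def)
  qed (use B in \<open>auto simp: indicator_def\<close>)
  also have "\<dots> = B * b" using b by simp
  finally show ?thesis
    using b by (simp add: interval_lebesgue_integral_def set_lebesgue_integral_def zero_ereal_def)
qed

section \<open>Integrals of the xor over intervals and rectangles\<close>

definition binxor_int :: "real \<Rightarrow> real \<Rightarrow> real" where
  "binxor_int t b = (LBINT s=0..ereal b. binxor s t)"

text \<open>This is the \<open>X\<close> of the overview, with the order of integration of
  \<open>xor_F\<close>: the first argument bounds the second operand of
  \<open>binxor\<close>.\<close>

definition binxor_int2 :: "real \<Rightarrow> real \<Rightarrow> real" where
  "binxor_int2 x y = (LBINT t=0..ereal x. binxor_int t y)"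

lemma binxor_abs_le: "\<bar>binxor x y\<bar> \<le> 1"
  using binxor_nonneg binxor_le_1 by simp

lemma binxor_int_abs_le: "0 \<le> b \<Longrightarrow> \<bar>binxor_int t b\<bar> \<le> b"
  unfolding binxor_int_def
  using interval_integral_abs_le[of "\<lambda>s. binxor s t" 1 b] by (simp add: binxor_abs_le)

lemma binxor_int_lborel:
  "0 \<le> b \<Longrightarrow> binxor_int t b = (LINT s|lborel. (if 0 < s \<and> s < b then binxor s t else 0))"
  unfolding binxor_int_def interval_lebesgue_integral_def set_lebesgue_integral_def
  by (auto simp: zero_ereal_def indicator_def intro!: Bochner_Integration.integral_cong)

text \<open>With the limits turned into conditions inside the integrand, \<open>x\<close> and
  \<open>y\<close> become parameters of one measurable integrand. This is the form from which
  \<open>borel_measurable_binxor_int2\<close> obtains joint measurability.\<close>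

lemma binxor_int2_lborel:
  "0 \<le> x \<Longrightarrow> 0 \<le> y \<Longrightarrow> binxor_int2 x y =
    (LINT t|lborel. (if 0 < t \<and> t < x then (LINT s|lborel. (if 0 < s \<and> s < y then binxor s t else 0)) else 0))"
  unfolding binxor_int2_def interval_lebesgue_integral_def set_lebesgue_integral_def
  by (auto simp: zero_ereal_def indicator_def binxor_int_lborel intro!: Bochner_Integration.integral_cong)

lemma borel_measurable_binxor_int [measurable]:
  assumes "0 \<le> b"
  shows "(\<lambda>t. binxor_int t b) \<in> borel_measurable borel"
  unfolding binxor_int_lborel[OF assms] by measurable

lemma binxor_int2_abs_le: "0 \<le> x \<Longrightarrow> 0 \<le> y \<Longrightarrow> \<bar>binxor_int2 x y\<bar> \<le> y * x"
  unfolding binxor_int2_def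
  by (rule interval_integral_abs_le) (auto intro: borel_measurable_binxor_int binxor_int_abs_le)

text \<open>The first digits contribute half their xor, the tails half of theirs, and the
  substitution in \<open>s\<close> another factor 1/2. In the second formula the lower half
  \<open>[0, 1/2]\<close> is complete and contributes with \<open>b = 1\<close>; on the upper half
  the first xor digit is \<open>1 - e\<close>.\<close>

lemma binxor_int_shift_half:
  assumes "0 \<le> t" "t < 1" "e \<le> 1" "0 \<le> b" "b \<le> 1"
  shows "binxor_int ((real e + t) / 2) (b / 2) = real e * b / 4 + binxor_int t b / 4"
    and "binxor_int ((real e + t) / 2) ((1 + b) / 2)
      = real e / 4 + binxor_int t 1 / 4 + (1 - real e) * b / 4 + binxor_int t b / 4"
proof -
  let ?f = "\<lambda>s. binxor s ((real e + t) / 2)"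
  have m: "?f \<in> borel_measurable borel" "(\<lambda>s. binxor s t) \<in> borel_measurable borel" by measurable
  have lo: "(LBINT u=0..ereal c. ?f (u / 2)) = real e / 2 * c + 1 / 2 * binxor_int t c"
    if "0 \<le> c" "c \<le> 1" for c
    unfolding binxor_int_def using that assms binxor_shift[of _ 0 t e]
    by (intro interval_integral_affine_cong[OF m(2) binxor_abs_le]) auto
  have hi: "(LBINT u=0..ereal c. ?f ((1 + u) / 2)) = (1 - real e) / 2 * c + 1 / 2 * binxor_int t c"
    if "0 \<le> c" "c \<le> 1" for c
  proof -
    have "?f ((1 + u) / 2) = (1 - real e) / 2 + 1 / 2 * binxor u t" if "0 \<le> u" "u < 1" for u
      using binxor_shift[of u 1 t e] that assms by (cases e) auto
    then show ?thesis
      unfolding binxor_int_def using that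
      by (intro interval_integral_affine_cong[OF m(2) binxor_abs_le]) auto
  qed
  show "binxor_int ((real e + t) / 2) (b / 2) = real e * b / 4 + binxor_int t b / 4"
    using interval_integral_halves(1)[OF m(1) binxor_abs_le assms(4)] lo[OF assms(4,5)]
    by (simp add: binxor_int_def)
  show "binxor_int ((real e + t) / 2) ((1 + b) / 2)
      = real e / 4 + binxor_int t 1 / 4 + (1 - real e) * b / 4 + binxor_int t b / 4"
    using interval_integral_halves(2)[OF m(1) binxor_abs_le assms(4)] lo[of 1] hi[OF assms(4,5)]
    by (simp add: binxor_int_def) (simp add: field_simps)
qed

section \<open>Exact values, recursion and reflection of the rectangle integrals\<close>

text \<open>Iterating the second assumption gives \<open>\<bar>f x\<bar> \<le> C * (1/2) ^ n\<close>
  for every \<open>n\<close>. It is applied to the difference of the two sides of an identity when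
  both obey the same digit recursion.\<close>

lemma eq_0_by_contraction:
  fixes f :: "'a \<Rightarrow> real"
  assumes "\<And>x. x \<in> A \<Longrightarrow> \<bar>f x\<bar> \<le> C"
    and "\<And>x. x \<in> A \<Longrightarrow> \<exists>y\<in>A. \<exists>c\<ge>2. f x = f y / c"
    and "x \<in> A"
  shows "f x = 0"
proof -
  have "\<forall>x\<in>A. \<bar>f x\<bar> \<le> C * (1/2) ^ n" for n
  proof (induction n)
    case (Suc n)
    show ?case
    proof
      fix x assume "x \<in> A"
      then obtain y c where y: "y \<in> A" "2 \<le> c" "f x = f y / c" using assms(2) by blast
      have "\<bar>f x\<bar> \<le> \<bar>f y\<bar> / 2"
        using y(2) unfolding y(3) abs_divide by (intro divide_left_mono) auto
      with Suc y(1) show "\<bar>f x\<bar> \<le> C * (1/2) ^ Suc n" by fastforce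
    qed
  qed (use assms(1) in simp)
  then have "\<forall>n. \<bar>f x\<bar> \<le> C * (1/2) ^ n" using assms(3) by blast
  moreover have "(\<lambda>n. C * (1/2) ^ n) \<longlonglongrightarrow> C * 0"
    by (intro tendsto_intros LIMSEQ_power_zero) simp
  ultimately have "\<bar>f x\<bar> \<le> 0"
    by (intro LIMSEQ_le_const[of "\<lambda>n. C * (1/2) ^ n" 0]) auto
  then show ?thesis by simp
qed

lemma unit_half_cases:
  fixes x :: real
  assumes "x \<in> {0..1}"
  obtains a where "a \<in> {0..1}" "x = a / 2" | a where "a \<in> {0..1}" "x = (1 + a) / 2"
proof (cases "x \<le> 1/2")
  case True
  then show ?thesis using assms that(1)[of "2 * x"] by simp
next
  case False
  then show ?thesis using assms that(2)[of "2 * x - 1"] by simp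
qed

text \<open>Flipping the digits of \<open>s\<close> that \<open>t\<close> selects preserves Lebesgue
  measure, so the mean of the xor is the mean of \<open>s\<close>. Formally, the deviation from 1/2
  at \<open>t\<close> is half the deviation at the tail of \<open>t\<close>.\<close>

lemma binxor_int_1:
  assumes "0 \<le> t" "t < 1"
  shows "binxor_int t 1 = 1 / 2"
proof -
  have "binxor_int t 1 - 1/2 = 0" if "t \<in> {0..<1}" for t
  proof (rule eq_0_by_contraction[OF _ _ that])
    show "\<bar>binxor_int t 1 - 1/2\<bar> \<le> 2" for t
      using binxor_int_abs_le[of 1 t] by simp
    fix t :: real assume t: "t \<in> {0..<1}"
    define e :: nat where "e = (if t < 1/2 then 0 else 1)"
    define u where "u = 2 * t - real e"
    have u: "u \<in> {0..<1}" "e \<le> 1" "t = (real e + u) / 2" using t by (auto simp: e_def u_def)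
    then have "binxor_int t 1 - 1/2 = (binxor_int u 1 - 1/2) / 2"
      using binxor_int_shift_half(2)[of u e 1] unfolding u(3) by (simp add: diff_divide_distrib)
    with u(1) show "\<exists>y\<in>{0..<1}. \<exists>c\<ge>2. binxor_int t 1 - 1/2 = (binxor_int y 1 - 1/2) / c"
      by (intro bexI[of _ u] exI[of _ 2]) simp_all
  qed
  from this[of t] assms show ?thesis by simp
qed

text \<open>The outer range is split at 1/2 and the inner integral rewritten by
  \<open>binxor_int_shift_half\<close>. The terms with first argument 1 come from a complete lower
  half of the outer range; their value \<open>y / 2\<close> is itself derived from this recursion,
  in \<open>binxor_int2_1\<close>.\<close>

lemma binxor_int2_halves:
  assumes "a \<in> {0..1}" "y \<in> {0..1}"
  shows "binxor_int2 (a / 2) (y / 2) = binxor_int2 a y / 8"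
    and "binxor_int2 (a / 2) ((1 + y) / 2) = a / 16 + a * y / 8 + binxor_int2 a y / 8"
    and "binxor_int2 ((1 + a) / 2) (y / 2) = a * y / 8 + binxor_int2 1 y / 8 + binxor_int2 a y / 8"
    and "binxor_int2 ((1 + a) / 2) ((1 + y) / 2)
      = 1 / 16 + y / 8 + binxor_int2 1 y / 8 + 3 * a / 16 + binxor_int2 a y / 8"
proof -
  have y: "0 \<le> y" "y \<le> 1" and a: "0 \<le> a" "a \<le> 1" using assms by auto
  have m: "(\<lambda>t. binxor_int t b) \<in> borel_measurable borel" if "0 \<le> b" for b
    using that by measurable
  note sh = interval_integral_affine_cong[OF m[OF y(1)] binxor_int_abs_le[OF y(1)]]
  have lo: "(LBINT u=0..ereal c. binxor_int (u / 2) (y / 2)) = 0 * c + 1/4 * binxor_int2 c y"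
     "(LBINT u=0..ereal c. binxor_int (u / 2) ((1 + y) / 2)) = (1/8 + y/4) * c + 1/4 * binxor_int2 c y"
     "(LBINT u=0..ereal c. binxor_int ((1 + u) / 2) (y / 2)) = y/4 * c + 1/4 * binxor_int2 c y"
     "(LBINT u=0..ereal c. binxor_int ((1 + u) / 2) ((1 + y) / 2)) = 3/8 * c + 1/4 * binxor_int2 c y"
    if "0 \<le> c" "c \<le> 1" for c
    unfolding binxor_int2_def
    using that y binxor_int_shift_half[of _ 0 y] binxor_int_shift_half[of _ 1 y]
    by - (rule sh; simp add: binxor_int_1)+
  have h: "binxor_int2 (a / 2) z = (LBINT u=0..ereal a. binxor_int (u / 2) z) / 2"
    "binxor_int2 ((1 + a) / 2) z = (LBINT u=0..ereal 1. binxor_int (u / 2) z) / 2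
      + (LBINT u=0..ereal a. binxor_int ((1 + u) / 2) z) / 2" if "0 \<le> z" for z
    unfolding binxor_int2_def
    by (rule interval_integral_halves[OF m[OF that] binxor_int_abs_le[OF that] a(1)])+
  show "binxor_int2 (a / 2) (y / 2) = binxor_int2 a y / 8"
    "binxor_int2 (a / 2) ((1 + y) / 2) = a / 16 + a * y / 8 + binxor_int2 a y / 8"
    "binxor_int2 ((1 + a) / 2) (y / 2) = a * y / 8 + binxor_int2 1 y / 8 + binxor_int2 a y / 8"
    "binxor_int2 ((1 + a) / 2) ((1 + y) / 2)
      = 1 / 16 + y / 8 + binxor_int2 1 y / 8 + 3 * a / 16 + binxor_int2 a y / 8"
    using h[of "y/2"] h[of "(1 + y)/2"] lo[OF a] lo[of 1] y by (simp_all add: field_simps)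
qed

text \<open>Since \<open>1 = (1 + 1) / 2\<close>, the recursion at first argument 1 leads back to
  first argument 1 and contains the integral twice. The deviation from \<open>y / 2\<close>
  therefore shrinks by the factor 4 instead of 8.\<close>

lemma binxor_int2_1:
  assumes "y \<in> {0..1}"
  shows "binxor_int2 1 y = y / 2"
proof -
  have "binxor_int2 1 y - y / 2 = 0"
  proof (rule eq_0_by_contraction[OF _ _ assms])
    show "\<bar>binxor_int2 1 y - y / 2\<bar> \<le> 2" if "y \<in> {0..1}" for y
      using binxor_int2_abs_le[of 1 y] that by auto
    fix y :: real assume "y \<in> {0..1}"
    then show "\<exists>z\<in>{0..1}. \<exists>c\<ge>2. binxor_int2 1 y - y / 2 = (binxor_int2 1 z - z / 2) / c"
    proof (cases rule: unit_half_cases)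
      case (1 a)
      then have "binxor_int2 1 y - y / 2 = (binxor_int2 1 a - a / 2) / 4"
        using binxor_int2_halves(3)[of 1 a] unfolding 1(2) by simp
      with 1(1) show ?thesis by (intro bexI[of _ a] exI[of _ 4]) simp_all
    next
      case (2 a)
      then have "binxor_int2 1 y - y / 2 = (binxor_int2 1 a - a / 2) / 4"
        using binxor_int2_halves(4)[of 1 a] unfolding 2(2) by (simp add: add_divide_distrib)
      with 2(1) show ?thesis by (intro bexI[of _ a] exI[of _ 4]) simp_all
    qed
  qed
  then show ?thesis by simp
qed

lemma binxor_int2_step:
  assumes "a \<in> {0..1}" "b \<in> {0..1}"
  shows "binxor_int2 (a / 2) (b / 2) = binxor_int2 a b / 8"
    and "binxor_int2 (a / 2) ((1 + b) / 2) = a / 16 + a * b / 8 + binxor_int2 a b / 8"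
    and "binxor_int2 ((1 + a) / 2) (b / 2) = b / 16 + a * b / 8 + binxor_int2 a b / 8"
    and "binxor_int2 ((1 + a) / 2) ((1 + b) / 2) = 1 / 16 + 3 * (a + b) / 16 + binxor_int2 a b / 8"
  using binxor_int2_halves[OF assms] binxor_int2_1[OF assms(2)] by (simp_all add: field_simps)

text \<open>Replacing \<open>t\<close> by \<open>1 - t\<close> complements almost surely all its
  digits, hence turns the xor into 1 minus itself. The integral over \<open>[0, 1 - a]\<close> is
  the full one, \<open>b / 2\<close>, minus the part over \<open>[1 - a, 1]\<close>, which reflects
  to \<open>a * b - binxor_int2 a b\<close>. The proof checks this by contraction.\<close>

lemma binxor_int2_reflect:
  assumes "a \<in> {0..1}" "b \<in> {0..1}"
  shows "binxor_int2 (1 - a) b = b / 2 - a * b + binxor_int2 a b"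
    and "binxor_int2 a (1 - b) = a / 2 - a * b + binxor_int2 a b"
proof -
  let ?A = "{0..1} \<times> {0..1::real}"
  let ?X = "binxor_int2"
  have bd: "\<bar>?X x y\<bar> \<le> 1" if "x \<in> {0..1}" "y \<in> {0..1}" for x y
    using binxor_int2_abs_le[of x y] that mult_le_one[of y x] by auto
  \<comment> \<open>Reflection exchanges the two halves of the unit interval and reflects the
    tail.\<close>
  have r: "1 - x / 2 = (1 + (1 - x)) / 2" "1 - (1 + x) / 2 = (1 - x) / 2" for x :: real
    by (auto simp: field_simps)
  \<comment> \<open>\<open>f\<close> and \<open>g\<close> are the defects of the two identities;
    both scale by exactly 1/8 when the first digits of \<open>x\<close> and \<open>y\<close> are
    removed.\<close>
  define f where "f = (\<lambda>(x, y). ?X (1 - x) y - (y / 2 - x * y + ?X x y))"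
  define g where "g = (\<lambda>(x, y). ?X x (1 - y) - (x / 2 - x * y + ?X x y))"
  have "\<bar>f p\<bar> \<le> 4 \<and> \<bar>g p\<bar> \<le> 4" if pA: "p \<in> ?A" for p
  proof -
    obtain x y where p: "p = (x, y)" "x \<in> {0..1}" "y \<in> {0..1}" using pA by auto
    have "0 \<le> x * y" "x * y \<le> 1" using p mult_le_one[of x y] by auto
    moreover have "\<bar>?X x y\<bar> \<le> 1" "\<bar>?X (1 - x) y\<bar> \<le> 1" "\<bar>?X x (1 - y)\<bar> \<le> 1"
      using p by (auto intro!: bd)
    ultimately show ?thesis
      using p(2,3) unfolding p f_def g_def prod.case atLeastAtMost_iff by (intro conjI; linarith)
  qed
  note bound = this
  have "\<exists>q\<in>?A. \<exists>c\<ge>2. f p = f q / c \<and> g p = g q / c" if pA: "p \<in> ?A" for p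
  proof -
    obtain x y where p: "p = (x, y)" "x \<in> {0..1}" "y \<in> {0..1}" using pA by auto
    obtain a b where ab: "a \<in> {0..1}" "b \<in> {0..1}"
      and xy: "x = a / 2 \<or> x = (1 + a) / 2" "y = b / 2 \<or> y = (1 + b) / 2"
      using p(2,3) by (metis unit_half_cases)
    have "f p = f (a, b) / 8 \<and> g p = g (a, b) / 8"
    proof -
      have "1 - a \<in> {0..1}" "1 - b \<in> {0..1}" using ab by auto
      note steps = binxor_int2_step[OF ab] binxor_int2_step[OF this(1) ab(2)] binxor_int2_step[OF ab(1) this(2)]
      show ?thesis
        using xy unfolding p f_def g_def prod.case
        by (elim disjE; hypsubst; (simp only: r(2))?; simp only: r(1) steps; simp add: field_simps)
    qed
    then show ?thesis using ab by (intro bexI[of _ "(a, b)"] exI[of _ 8]) auto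
  qed
  note step = this
  have "f (a, b) = 0"
    by (rule eq_0_by_contraction[where A = ?A]) (use bound step assms in blast)+
  moreover have "g (a, b) = 0"
    by (rule eq_0_by_contraction[where A = ?A]) (use bound step assms in blast)+
  ultimately show "?X (1 - a) b = b / 2 - a * b + ?X a b" "?X a (1 - b) = a / 2 - a * b + ?X a b"
    by (auto simp: f_def g_def)
qed

section \<open>Nonnegativity of the gap\<close>

text \<open>This is \<Phi> of the overview, as \<open>xor_F_sum\<close> confirms. Each diagonal term
  occurs with weight 1/4 in two of the three values of F, whence the factor 1/2.\<close>

definition xor_gap :: "real \<Rightarrow> real \<Rightarrow> real \<Rightarrow> real" where
  "xor_gap x y z = x * y * z - binxor_int2 x y - binxor_int2 x z - binxor_int2 y z
    + (binxor_int2 x x + binxor_int2 y y + binxor_int2 z z) / 2"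

text \<open>Eight times the gap at \<open>((1 + a)/2, (1 + b)/2, (1 + c)/2)\<close> minus the gap at \<open>(a, b, c)\<close>.\<close>

definition odd_corr :: "real \<Rightarrow> real \<Rightarrow> real \<Rightarrow> real" where
  "odd_corr a b c = a * b + b * c + c * a - (a + b + c) / 2 + 1 / 4"

lemma binxor_int2_abs_le_1:
  "x \<in> {0..1} \<Longrightarrow> y \<in> {0..1} \<Longrightarrow> \<bar>binxor_int2 x y\<bar> \<le> 1"
  using binxor_int2_abs_le[of x y] mult_le_one[of y x] by auto

text \<open>A crude bound that starts both digit inductions, the one for nonnegativity and the one
  for smallness on the support of the couplings.\<close>

lemma xor_gap_abs_le:
  assumes "x \<in> {0..1}" "y \<in> {0..1}" "z \<in> {0..1}"
  shows "\<bar>xor_gap x y z\<bar> \<le> 6"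
proof -
  have "0 \<le> x * y * z" "x * y * z \<le> 1"
    using assms mult_le_one[of "x * y" z] mult_le_one[of x y] by auto
  then show ?thesis
    using binxor_int2_abs_le_1[OF assms(1,2)] binxor_int2_abs_le_1[OF assms(1,3)]
      binxor_int2_abs_le_1[OF assms(2,3)] binxor_int2_abs_le_1[OF assms(1,1)]
      binxor_int2_abs_le_1[OF assms(2,2)] binxor_int2_abs_le_1[OF assms(3,3)]
    unfolding xor_gap_def abs_le_iff add_divide_distrib by - (elim conjE; intro conjI; linarith)
qed

text \<open>The polynomial terms created by \<open>binxor_int2_reflect\<close> cancel against those
  of the reflected product. This lets the odd cases of \<open>xor_gap_step\<close> be read as gap
  plus correction at one common point.\<close>

lemma xor_gap_reflect:
  assumes "a \<in> {0..1}" "b \<in> {0..1}" "c \<in> {0..1}"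
  shows "xor_gap a (1 - b) (1 - c) = xor_gap a b c"
    and "xor_gap (1 - a) b (1 - c) = xor_gap a b c"
    and "xor_gap (1 - a) (1 - b) c = xor_gap a b c"
proof -
  have r: "1 - a \<in> {0..1}" "1 - b \<in> {0..1}" "1 - c \<in> {0..1}" using assms by auto
  note R = binxor_int2_reflect
  note eqs = R[OF assms(1,2)] R[OF assms(1,3)] R[OF assms(2,3)]
    R[OF assms(1,1)] R[OF assms(2,2)] R[OF assms(3,3)]
    R(1)[OF assms(1) r(1)] R(1)[OF assms(1) r(2)] R(1)[OF assms(1) r(3)]
    R(1)[OF assms(2) r(2)] R(1)[OF assms(2) r(3)] R(1)[OF assms(3) r(3)]
  show "xor_gap a (1 - b) (1 - c) = xor_gap a b c"
    "xor_gap (1 - a) b (1 - c) = xor_gap a b c"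
    "xor_gap (1 - a) (1 - b) c = xor_gap a b c"
    unfolding xor_gap_def eqs by (simp_all add: field_simps)
qed

text \<open>Substitution of \<open>binxor_int2_step\<close>; all remaining polynomials cancel when
  the first digits have even sum. When the sum is odd, the correction is taken with those
  coordinates reflected whose first digit is 0.\<close>

lemma xor_gap_step:
  assumes "a \<in> {0..1}" "b \<in> {0..1}" "c \<in> {0..1}"
  shows "xor_gap (a/2) (b/2) (c/2) = xor_gap a b c / 8"
    and "xor_gap (a/2) ((1 + b)/2) ((1 + c)/2) = xor_gap a b c / 8"
    and "xor_gap ((1 + a)/2) (b/2) ((1 + c)/2) = xor_gap a b c / 8"
    and "xor_gap ((1 + a)/2) ((1 + b)/2) (c/2) = xor_gap a b c / 8"
    and "xor_gap ((1 + a)/2) ((1 + b)/2) ((1 + c)/2) = (xor_gap a b c + odd_corr a b c) / 8"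
    and "xor_gap ((1 + a)/2) (b/2) (c/2) = (xor_gap a b c + odd_corr a (1 - b) (1 - c)) / 8"
    and "xor_gap (a/2) ((1 + b)/2) (c/2) = (xor_gap a b c + odd_corr (1 - a) b (1 - c)) / 8"
    and "xor_gap (a/2) (b/2) ((1 + c)/2) = (xor_gap a b c + odd_corr (1 - a) (1 - b) c) / 8"
proof -
  note S = binxor_int2_step
  note eqs = S[OF assms(1,2)] S[OF assms(1,3)] S[OF assms(2,3)]
    S[OF assms(1,1)] S[OF assms(2,2)] S[OF assms(3,3)]
  show "xor_gap (a/2) (b/2) (c/2) = xor_gap a b c / 8"
    "xor_gap (a/2) ((1 + b)/2) ((1 + c)/2) = xor_gap a b c / 8"
    "xor_gap ((1 + a)/2) (b/2) ((1 + c)/2) = xor_gap a b c / 8"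
    "xor_gap ((1 + a)/2) ((1 + b)/2) (c/2) = xor_gap a b c / 8"
    "xor_gap ((1 + a)/2) ((1 + b)/2) ((1 + c)/2) = (xor_gap a b c + odd_corr a b c) / 8"
    "xor_gap ((1 + a)/2) (b/2) (c/2) = (xor_gap a b c + odd_corr a (1 - b) (1 - c)) / 8"
    "xor_gap (a/2) ((1 + b)/2) (c/2) = (xor_gap a b c + odd_corr (1 - a) b (1 - c)) / 8"
    "xor_gap (a/2) (b/2) ((1 + c)/2) = (xor_gap a b c + odd_corr (1 - a) (1 - b) c) / 8"
    unfolding xor_gap_def odd_corr_def eqs by (simp_all add: field_simps)
qed

text \<open>If the first digits have even sum, the gap is an eighth of the previous one and the
  correction at the current point is nonnegative. If the sum is odd, the inherited correction and
  the one at the current point together are at least \<open>odd_corr a b c / 8\<close>.\<close>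

lemma xor_gap_odd_corr_step:
  assumes "a \<in> {0..1}" "b \<in> {0..1}" "c \<in> {0..1}"
  defines "P \<equiv> \<lambda>x y z. xor_gap x y z + odd_corr x y z"
  shows "xor_gap a b c / 8 \<le> P (a/2) (b/2) (c/2)"
    and "xor_gap a b c / 8 \<le> P (a/2) ((1 + b)/2) ((1 + c)/2)"
    and "xor_gap a b c / 8 \<le> P ((1 + a)/2) (b/2) ((1 + c)/2)"
    and "xor_gap a b c / 8 \<le> P ((1 + a)/2) ((1 + b)/2) (c/2)"
    and "P a b c / 8 \<le> P ((1 + a)/2) ((1 + b)/2) ((1 + c)/2)"
    and "P a b c / 8 \<le> P ((1 + a)/2) (b/2) (c/2)"
    and "P a b c / 8 \<le> P (a/2) ((1 + b)/2) (c/2)"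
    and "P a b c / 8 \<le> P (a/2) (b/2) ((1 + c)/2)"
proof -
  have pos: "0 \<le> a" "0 \<le> b" "0 \<le> c" "0 \<le> a * b" "0 \<le> b * c" "0 \<le> a * c" "0 \<le> a * b * c"
    "0 \<le> (1 - a) * (1 - b) * (1 - c)"
    using assms(1-3) by auto
  \<comment> \<open>The difference of the two sides is
    \<open>(1 - a) * (1 - b) * (1 - c) + a * b * c\<close>.\<close>
  have "a + b + c \<le> 1 + a * b + b * c + a * c"
    using pos(7,8) by (simp add: algebra_simps)
  then show "xor_gap a b c / 8 \<le> P (a/2) (b/2) (c/2)"
    unfolding P_def xor_gap_step[OF assms(1-3)] odd_corr_def by (simp add: field_simps)
  \<comment> \<open>In each case the difference of the sides is a polynomial in \<open>a\<close>,
    \<open>b\<close>, \<open>c\<close> with nonnegative coefficients; at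
    \<open>((1 + a)/2, b/2, c/2)\<close> it is \<open>b * c / 4\<close>.\<close>
  show "xor_gap a b c / 8 \<le> P (a/2) ((1 + b)/2) ((1 + c)/2)"
    "xor_gap a b c / 8 \<le> P ((1 + a)/2) (b/2) ((1 + c)/2)"
    "xor_gap a b c / 8 \<le> P ((1 + a)/2) ((1 + b)/2) (c/2)"
    "P a b c / 8 \<le> P ((1 + a)/2) ((1 + b)/2) ((1 + c)/2)"
    "P a b c / 8 \<le> P ((1 + a)/2) (b/2) (c/2)"
    "P a b c / 8 \<le> P (a/2) ((1 + b)/2) (c/2)"
    "P a b c / 8 \<le> P (a/2) (b/2) ((1 + c)/2)"
    using pos(1-6) unfolding P_def xor_gap_step[OF assms(1-3)] odd_corr_def by (simp_all add: field_simps)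
qed

lemma xor_gap_nonneg:
  assumes "x \<in> {0..1}" "y \<in> {0..1}" "z \<in> {0..1}"
  shows "0 \<le> xor_gap x y z"
proof -
  have "\<forall>x\<in>{0..1}. \<forall>y\<in>{0..1}. \<forall>z\<in>{0..1}.
      - 8 * (1/8) ^ n \<le> xor_gap x y z \<and> - 8 * (1/8) ^ n \<le> xor_gap x y z + odd_corr x y z" for n
  proof (induction n)
    case 0
    show ?case
    proof (intro ballI)
      fix x y z :: real assume u: "x \<in> {0..1}" "y \<in> {0..1}" "z \<in> {0..1}"
      \<comment> \<open>The gap is at least -6 and the correction at least -3/2 + 1/4, so -8 bounds
        both functions below.\<close>
      have "0 \<le> x * y" "0 \<le> y * z" "0 \<le> z * x" "x + y + z \<le> 3" using u by auto
      then show "- 8 * (1/8) ^ 0 \<le> xor_gap x y z \<and> - 8 * (1/8) ^ 0 \<le> xor_gap x y z + odd_corr x y z"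
        using xor_gap_abs_le[OF u] unfolding odd_corr_def abs_le_iff power_0 add_divide_distrib by - (elim conjE; intro conjI; linarith)
    qed
  next
    case (Suc n)
    let ?m = "- 8 * (1/8 :: real) ^ n"
    have IH: "?m \<le> xor_gap x y z" "?m \<le> xor_gap x y z + odd_corr x y z"
      if "x \<in> {0..1}" "y \<in> {0..1}" "z \<in> {0..1}" for x y z
      using Suc.IH that by blast+
    show ?case
    proof (intro ballI)
      fix x y z :: real assume u: "x \<in> {0..1}" "y \<in> {0..1}" "z \<in> {0..1}"
      obtain a where a: "a \<in> {0..1}" "x = a/2 \<or> x = (1 + a)/2"
        using u(1) by (metis unit_half_cases)
      obtain b where b: "b \<in> {0..1}" "y = b/2 \<or> y = (1 + b)/2"
        using u(2) by (metis unit_half_cases)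
      obtain c where c: "c \<in> {0..1}" "z = c/2 \<or> z = (1 + c)/2"
        using u(3) by (metis unit_half_cases)
      have r: "1 - a \<in> {0..1}" "1 - b \<in> {0..1}" "1 - c \<in> {0..1}" using a(1) b(1) c(1) by auto
      note refl = xor_gap_reflect[OF a(1) b(1) c(1)]
      \<comment> \<open>In the odd cases the induction hypothesis is used at a point with two
        reflected coordinates; there the gap equals \<open>xor_gap a b c\<close>, so the hypothesis
        bounds exactly the numerator in \<open>xor_gap_step\<close>.\<close>
      have "?m / 8 \<le> xor_gap x y z"
        using a(2) b(2) c(2) IH[OF a(1) b(1) c(1)] IH(2)[OF a(1) r(2,3)] IH(2)[OF r(1) b(1) r(3)]
          IH(2)[OF r(1,2) c(1)] unfolding refl
        by (elim disjE; hypsubst; simp only: xor_gap_step[OF a(1) b(1) c(1)]; simp)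
      moreover have "?m / 8 \<le> xor_gap x y z + odd_corr x y z"
      proof -
        have "?m / 8 \<le> xor_gap a b c / 8" "?m / 8 \<le> (xor_gap a b c + odd_corr a b c) / 8"
          using IH[OF a(1) b(1) c(1)] by (intro divide_right_mono; simp)+
        then show ?thesis
          using a(2) b(2) c(2) xor_gap_odd_corr_step[OF a(1) b(1) c(1)]
          by (elim disjE; hypsubst; blast intro: order_trans)
      qed
      ultimately show "- 8 * (1/8) ^ Suc n \<le> xor_gap x y z
          \<and> - 8 * (1/8) ^ Suc n \<le> xor_gap x y z + odd_corr x y z" by simp
    qed
  qed
  then have "\<forall>n. - 8 * (1/8) ^ n \<le> xor_gap x y z" using assms by blast
  moreover have "(\<lambda>n. - 8 * (1/8 :: real) ^ n) \<longlonglongrightarrow> - 8 * 0"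
    by (intro tendsto_intros LIMSEQ_power_zero) simp
  ultimately show ?thesis
    by (intro LIMSEQ_le_const2[of "\<lambda>n. - 8 * (1/8) ^ n" 0]) auto
qed

section \<open>The gap in terms of F, and its size where the leading digits have even sums\<close>

lemma xor_F_eq:
  assumes "0 \<le> x" "0 \<le> y"
  shows "xor_F x y = binxor_int2 x y - binxor_int2 x x / 4 - binxor_int2 y y / 4"
  unfolding xor_F_def binxor_int2_def binxor_int_def by simp

lemma xor_F_sum:
  assumes "x \<in> {0..1}" "y \<in> {0..1}" "z \<in> {0..1}"
  shows "xor_F x y + xor_F x z + xor_F y z = x * y * z - xor_gap x y z"
  using assms by (simp add: xor_F_eq xor_gap_def add_divide_distrib)

text \<open>Digits are read off by doubling, so that the recursion matches
  \<open>xor_gap_step\<close>. For \<open>x\<close> in \<open>[0,1)\<close>, the first digit is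
  \<open>\<lfloor>2 * x\<rfloor>\<close> and the tail is \<open>frac (2 * x)\<close>.\<close>

primrec xor_even :: "nat \<Rightarrow> real \<Rightarrow> real \<Rightarrow> real \<Rightarrow> bool" where
  "xor_even 0 x y z = True"
| "xor_even (Suc n) x y z =
    (even (\<lfloor>2 * x\<rfloor> + \<lfloor>2 * y\<rfloor> + \<lfloor>2 * z\<rfloor>) \<and> xor_even n (frac (2 * x)) (frac (2 * y)) (frac (2 * z)))"

lemma unit_floor_cases:
  fixes x :: real
  assumes "x \<in> {0..<1}"
  obtains "\<lfloor>2 * x\<rfloor> = 0" "x = frac (2 * x) / 2" | "\<lfloor>2 * x\<rfloor> = 1" "x = (1 + frac (2 * x)) / 2"
proof (cases "x < 1/2")
  case True
  then have "\<lfloor>2 * x\<rfloor> = 0" using assms by (simp add: floor_eq_iff)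
  then show ?thesis using that(1) by (simp add: frac_def)
next
  case False
  then have "\<lfloor>2 * x\<rfloor> = 1" using assms by (simp add: floor_eq_iff)
  then show ?thesis using that(2) by (simp add: frac_def)
qed

text \<open>Only the four even cases of \<open>xor_gap_step\<close> can occur at each of the
  \<open>n\<close> digits, so the gap is exactly \<open>(1/8) ^ n\<close> times its value at the
  tails, which is at most 6.\<close>

lemma xor_gap_le_of_xor_even:
  assumes "xor_even n x y z" "x \<in> {0..<1}" "y \<in> {0..<1}" "z \<in> {0..<1}"
  shows "xor_gap x y z \<le> 6 * (1/8) ^ n"
  using assms
proof (induction n arbitrary: x y z)
  case 0
  then show ?case using xor_gap_abs_le[of x y z] by simp
next
  case (Suc n)
  define a b c where abc: "a = frac (2 * x)" "b = frac (2 * y)" "c = frac (2 * z)"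
  have h: "a \<in> {0..<1}" "b \<in> {0..<1}" "c \<in> {0..<1}" by (auto simp: abc frac_lt_1)
  then have u: "a \<in> {0..1}" "b \<in> {0..1}" "c \<in> {0..1}" by auto
  have par: "even (\<lfloor>2 * x\<rfloor> + \<lfloor>2 * y\<rfloor> + \<lfloor>2 * z\<rfloor>)" and e: "xor_even n a b c"
    using Suc.prems(1) by (simp_all add: abc)
  have "xor_gap x y z = xor_gap a b c / 8"
    using Suc.prems(2,3,4)[THEN unit_floor_cases, folded abc] par xor_gap_step(1-4)[OF u]
    by (smt (verit) odd_one even_add even_zero)
  then show ?case using Suc.IH[OF e h] by simp
qed

lemma xor_even_permute:
  "xor_even n x z y = xor_even n x y z" "xor_even n y z x = xor_even n x y z"
  by (induction n arbitrary: x y z) (auto simp: ac_simps)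

text \<open>The digits of \<open>x\<close> and \<open>y\<close> force the first \<open>n\<close>
  digits of \<open>z\<close> by parity and leave the later ones free, so the admissible
  \<open>z\<close> in \<open>[0,1)\<close> form a single dyadic interval of length
  \<open>1 / 2 ^ n\<close>.\<close>

lemma xor_even_slice:
  "\<exists>k<2 ^ n. \<forall>z\<in>{0..<1}. xor_even n x y z \<longleftrightarrow> real k / 2 ^ n \<le> z \<and> z < (real k + 1) / 2 ^ n"
proof (induction n arbitrary: x y)
  case 0
  then show ?case by auto
next
  case (Suc n)
  from Suc.IH[of "frac (2 * x)" "frac (2 * y)"] obtain k where k: "k < 2 ^ n"
    "\<And>z. z \<in> {0..<1} \<Longrightarrow> xor_even n (frac (2 * x)) (frac (2 * y)) z
      \<longleftrightarrow> real k / 2 ^ n \<le> z \<and> z < (real k + 1) / 2 ^ n"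
    by blast
  \<comment> \<open>\<open>d\<close> is the forced first digit of \<open>z\<close>; prefixing it to
    the \<open>n\<close> digits encoded by \<open>k\<close> gives
    \<open>d * 2 ^ n + k\<close>.\<close>
  define d :: nat where "d = (if even (\<lfloor>2 * x\<rfloor> + \<lfloor>2 * y\<rfloor>) then 0 else 1)"
  have k1: "real k / 2 ^ n \<ge> 0" "(real k + 1) / 2 ^ n \<le> 1"
  proof -
    have "real (k + 1) \<le> real (2 ^ n)" using k(1) by (intro of_nat_mono) simp
    then show "(real k + 1) / 2 ^ n \<le> 1" by simp
  qed simp
  show ?case
  proof (intro exI[of _ "d * 2 ^ n + k"] conjI ballI)
    show "d * 2 ^ n + k < 2 ^ Suc n" using k(1) by (simp add: d_def)
    fix z :: real assume z: "z \<in> {0..<1}"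
    have eq: "real (d * 2 ^ n + k) / 2 ^ Suc n = (real d + real k / 2 ^ n) / 2"
      "(real (d * 2 ^ n + k) + 1) / 2 ^ Suc n = (real d + (real k + 1) / 2 ^ n) / 2"
      by (simp_all add: field_simps)
    have "xor_even (Suc n) x y z \<longleftrightarrow> \<lfloor>2 * z\<rfloor> = int d
        \<and> real k / 2 ^ n \<le> frac (2 * z) \<and> frac (2 * z) < (real k + 1) / 2 ^ n"
      using k(2)[of "frac (2 * z)"] by - (rule unit_floor_cases[OF z]; auto simp: d_def frac_lt_1)
    also have "\<dots> \<longleftrightarrow> real (d * 2 ^ n + k) / 2 ^ Suc n \<le> z \<and> z < (real (d * 2 ^ n + k) + 1) / 2 ^ Suc n"
    proof -
      have "\<lfloor>2 * z\<rfloor> = int d \<longleftrightarrow> 0 \<le> 2 * z - real d \<and> 2 * z - real d < 1"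
        by (auto simp: floor_eq_iff)
      moreover have "frac (2 * z) = 2 * z - real d" if "\<lfloor>2 * z\<rfloor> = int d"
        using that by (simp add: frac_def)
      \<comment> \<open>The floor condition is absorbed: since \<open>0 \<le> A\<close> and
        \<open>B \<le> 1\<close>, the bounds on \<open>2 * z - real d\<close> already place it in
        \<open>[0,1)\<close>.\<close>
      ultimately have "(\<lfloor>2 * z\<rfloor> = int d \<and> A \<le> frac (2 * z) \<and> frac (2 * z) < B)
          \<longleftrightarrow> (A \<le> 2 * z - real d \<and> 2 * z - real d < B)" if "0 \<le> A" "B \<le> 1" for A B
        using that by (smt (verit))
      moreover have "(real d + r) / 2 \<le> z \<longleftrightarrow> r \<le> 2 * z - real d"
        "z < (real d + r) / 2 \<longleftrightarrow> 2 * z - real d < r" for r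
        by auto
      ultimately show ?thesis unfolding eq using k1 by simp
    qed
    finally show "xor_even (Suc n) x y z \<longleftrightarrow>
      real (d * 2 ^ n + k) / 2 ^ Suc n \<le> z \<and> z < (real (d * 2 ^ n + k) + 1) / 2 ^ Suc n" .
  qed
qed

section \<open>Integrability and feasibility of F\<close>

lemma borel_measurable_binxor_int2:
  assumes [measurable]: "f \<in> borel_measurable M" "g \<in> borel_measurable M"
    and pos: "\<And>p. p \<in> space M \<Longrightarrow> 0 \<le> f p \<and> 0 \<le> g p"
  shows "(\<lambda>p. binxor_int2 (f p) (g p)) \<in> borel_measurable M"
proof -
  have "(\<lambda>p. LINT t|lborel. (if 0 < t \<and> t < f p then (LINT s|lborel. (if 0 < s \<and> s < g p then binxor s t else 0)) else 0))
      \<in> borel_measurable M"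
    by measurable
  then show ?thesis
    by (rule measurable_cong[THEN iffD2, rotated]) (simp add: binxor_int2_lborel pos)
qed

lemma xor_F_integrable: "set_integrable lebesgue ({0..1} \<times> {0..1}) (\<lambda>(x, y). xor_F x y)"
proof -
  let ?S = "{0..1} \<times> {0..1} :: (real \<times> real) set"
  \<comment> \<open>The absolute values give nonnegative limits on the whole plane, as
    \<open>borel_measurable_binxor_int2\<close> demands, and change nothing on the square.\<close>
  define h where "h p = binxor_int2 (abs (fst p)) (abs (snd p)) - binxor_int2 (abs (fst p)) (abs (fst p)) / 4
    - binxor_int2 (abs (snd p)) (abs (snd p)) / 4" for p :: "real \<times> real"
  have "(\<lambda>p :: real \<times> real. abs (fst p)) \<in> borel_measurable borel"
    "(\<lambda>p :: real \<times> real. abs (snd p)) \<in> borel_measurable borel"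
    by (intro borel_measurable_continuous_onI continuous_intros)+
  then have [measurable]: "h \<in> borel_measurable borel"
    unfolding h_def
    by (intro borel_measurable_diff borel_measurable_divide borel_measurable_binxor_int2) simp_all
  have S: "?S \<in> sets borel" by (intro borel_closed closed_Times) auto
  have fin: "emeasure lborel ?S < \<infinity>" by (rule emeasure_bounded_finite) (simp add: bounded_Times)
  have hF: "h p = (case p of (x, y) \<Rightarrow> xor_F x y)" if "p \<in> ?S" for p
    using that by (auto simp: h_def xor_F_eq)
  have "\<bar>h p\<bar> \<le> 2" if "p \<in> ?S" for p
  proof -
    have u: "fst p \<in> {0..1}" "snd p \<in> {0..1}" using that by auto
    then show ?thesis
      using binxor_int2_abs_le_1[OF u] binxor_int2_abs_le_1[OF u(1) u(1)] binxor_int2_abs_le_1[OF u(2) u(2)]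
      by (simp add: h_def)
  qed
  then have I: "integrable lborel (\<lambda>p. indicator ?S p *\<^sub>R h p)"
    using S fin by (intro integrableI_bounded_set_indicator[where B = 2]) auto
  have "integrable lebesgue (\<lambda>p. indicator ?S p *\<^sub>R h p)"
    by (rule integrable_completion[OF borel_measurable_integrable[OF I], THEN iffD2, OF I])
  then show ?thesis
    unfolding set_integrable_def
    by (rule Bochner_Integration.integrable_cong[THEN iffD1, rotated 2]) (auto simp: hF indicator_def)
qed

lemma xor_F_feasible: "dual_feasible xor_F"
  unfolding dual_feasible_def using xor_F_integrable xor_F_sum xor_gap_nonneg
  by (metis diff_ge_0_iff_ge diff_diff_eq2 add_diff_cancel_left')

section \<open>Almost optimal couplings\<close>

text \<open>The height \<open>2 ^ n\<close> is the reciprocal of the length of the slices in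
  \<open>xor_even_slice\<close>, so that every slice over the square has mass 1.\<close>

definition coupling_density :: "nat \<Rightarrow> real \<Rightarrow> real \<Rightarrow> real \<Rightarrow> ennreal" where
  "coupling_density n x y z =
    (if x \<in> {0..<1} \<and> y \<in> {0..<1} \<and> z \<in> {0..<1} \<and> xor_even n x y z then 2 ^ n else 0)"

definition coupling :: "nat \<Rightarrow> (real \<times> real \<times> real) measure" where
  "coupling n = density lborel (\<lambda>(x, y, z). coupling_density n x y z)"

text \<open>The square is half-open to agree exactly with the marginals of
  \<open>coupling n\<close>; the omitted edges are null sets.\<close>

definition unit_square :: "(real \<times> real) measure" where
  "unit_square = density lborel (indicator ({0..<1} \<times> {0..<1}))"

section \<open>Marginals and support of the couplings\<close>

lemma measurable_xor_even [measurable]: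
  assumes "f \<in> borel_measurable M" "g \<in> borel_measurable M" "h \<in> borel_measurable M"
  shows "Measurable.pred M (\<lambda>w. xor_even n (f w) (g w) (h w))"
  using assms
proof (induction n arbitrary: f g h)
  case (Suc n)
  note [measurable] = Suc.prems
  have fr: "(\<lambda>w. frac (2 * k w)) \<in> borel_measurable M" if [measurable]: "k \<in> borel_measurable M" for k :: "_ \<Rightarrow> real"
    unfolding frac_def by measurable
  note [measurable] = Suc.IH[OF fr[OF Suc.prems(1)] fr[OF Suc.prems(2)] fr[OF Suc.prems(3)]]
  show ?case unfolding xor_even.simps by measurable
qed simp

lemma borel_measurable_coupling_density [measurable]:
  assumes [measurable]: "f \<in> borel_measurable M" "g \<in> borel_measurable M" "h \<in> borel_measurable M"
  shows "(\<lambda>w. coupling_density n (f w) (g w) (h w)) \<in> borel_measurable M"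
  unfolding coupling_density_def by measurable

lemma coupling_density_permute:
  "coupling_density n x z y = coupling_density n x y z"
  "coupling_density n y z x = coupling_density n x y z"
  unfolding coupling_density_def using xor_even_permute[where n = n and x = x and y = y and z = z] by auto

lemma nn_integral_coupling_density:
  "(\<integral>\<^sup>+z. coupling_density n x y z \<partial>lborel) = indicator ({0..<1} \<times> {0..<1}) (x, y)"
proof (cases "x \<in> {0..<1} \<and> y \<in> {0..<1}")
  case True
  obtain k where k: "k < 2 ^ n" "\<And>z. z \<in> {0..<1} \<Longrightarrow> xor_even n x y z
      \<longleftrightarrow> real k / 2 ^ n \<le> z \<and> z < (real k + 1) / 2 ^ n"
    using xor_even_slice by blast
  have "real (k + 1) \<le> real (2 ^ n)" using k(1) by (intro of_nat_mono) simp
  then have k1: "0 \<le> real k / 2 ^ n" "(real k + 1) / 2 ^ n \<le> 1" by simp_all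
  have "z \<in> {0..<1}" if "real k / 2 ^ n \<le> z" "z < (real k + 1) / 2 ^ n" for z
    unfolding atLeastLessThan_iff using k1 that by linarith
  then have "coupling_density n x y z = 2 ^ n * indicator {real k / 2 ^ n..<(real k + 1) / 2 ^ n} z" for z
    using k(2)[of z] True by (auto simp: coupling_density_def indicator_def)
  then have "(\<integral>\<^sup>+z. coupling_density n x y z \<partial>lborel)
      = 2 ^ n * emeasure lborel {real k / 2 ^ n..<(real k + 1) / 2 ^ n}"
    by (simp add: nn_integral_cmult_indicator)
  also have "\<dots> = ennreal (2 ^ n) * ennreal (1 / 2 ^ n)"
    by (simp add: divide_right_mono diff_divide_distrib[symmetric] ennreal_power[symmetric])
  also have "\<dots> = 1" by (simp add: ennreal_mult[symmetric])
  finally show ?thesis using True by simp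
next
  case False
  then have "coupling_density n x y z = 0" for z by (auto simp: coupling_density_def)
  with False show ?thesis by (auto simp: indicator_def)
qed

lemma borel_measurable_fst_snd [measurable]:
  "fst \<in> borel_measurable (borel :: ('a::topological_space \<times> 'b::topological_space) measure)"
  "snd \<in> borel_measurable (borel :: ('a \<times> 'b) measure)"
  by (intro borel_measurable_continuous_onI continuous_intros)+

lemma nn_integral_lborel_triple:
  fixes h :: "real \<times> real \<times> real \<Rightarrow> ennreal"
  assumes [measurable]: "h \<in> borel_measurable borel"
  shows "(\<integral>\<^sup>+w. h w \<partial>lborel) = (\<integral>\<^sup>+x. \<integral>\<^sup>+y. \<integral>\<^sup>+z. h (x, y, z) \<partial>lborel \<partial>lborel \<partial>lborel)"
proof -
  have "(\<integral>\<^sup>+w. h w \<partial>lborel) = (\<integral>\<^sup>+w. h w \<partial>(lborel \<Otimes>\<^sub>M lborel))"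
    by (simp add: lborel_prod)
  also have "\<dots> = (\<integral>\<^sup>+x. \<integral>\<^sup>+p. h (x, p) \<partial>lborel \<partial>lborel)"
    by (intro lborel.nn_integral_fst[symmetric]) (simp add: lborel_prod)
  also have "\<dots> = (\<integral>\<^sup>+x. \<integral>\<^sup>+p. h (x, p) \<partial>(lborel \<Otimes>\<^sub>M lborel) \<partial>lborel)"
    by (simp add: lborel_prod)
  also have "\<dots> = (\<integral>\<^sup>+x. \<integral>\<^sup>+y. \<integral>\<^sup>+z. h (x, y, z) \<partial>lborel \<partial>lborel \<partial>lborel)"
    by (intro nn_integral_cong lborel.nn_integral_fst[symmetric]) (simp add: lborel_prod)
  finally show ?thesis .
qed

lemma nn_integral_unit_square:
  assumes [measurable]: "f \<in> borel_measurable borel"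
  shows "(\<integral>\<^sup>+p. f p \<partial>unit_square)
    = (\<integral>\<^sup>+x. \<integral>\<^sup>+y. f (x, y) * indicator ({0..<1} \<times> {0..<1}) (x, y) \<partial>lborel \<partial>lborel)"
proof -
  have m: "{0..<1} \<times> {0..<1} \<in> sets (borel :: (real \<times> real) measure)"
    by (simp flip: borel_prod)
  note [measurable] = m
  have "(\<integral>\<^sup>+p. f p \<partial>unit_square)
      = (\<integral>\<^sup>+p. f p * indicator ({0..<1} \<times> {0..<1}) p \<partial>(lborel \<Otimes>\<^sub>M lborel))"
    unfolding unit_square_def by (subst nn_integral_density) (auto simp: lborel_prod mult.commute)
  also have "\<dots> = (\<integral>\<^sup>+x. \<integral>\<^sup>+y. f (x, y) * indicator ({0..<1} \<times> {0..<1}) (x, y) \<partial>lborel \<partial>lborel)"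
    by (intro lborel.nn_integral_fst[symmetric]) (simp add: lborel_prod)
  finally show ?thesis .
qed

lemma nn_integral_swap_lborel:
  fixes h :: "real \<times> real \<Rightarrow> ennreal"
  assumes "h \<in> borel_measurable borel"
  shows "(\<integral>\<^sup>+x. \<integral>\<^sup>+y. h (x, y) \<partial>lborel \<partial>lborel) = (\<integral>\<^sup>+y. \<integral>\<^sup>+x. h (x, y) \<partial>lborel \<partial>lborel)"
  using lborel_pair.Fubini[of h] assms by (simp add: lborel_prod)

text \<open>Integrating out the last variable is immediate from the slice masses. For the other two
  projections Tonelli moves the missing variable innermost, and the symmetry of the density makes it
  the last argument.\<close>

lemma nn_integral_coupling_marginals:
  fixes f :: "real \<times> real \<Rightarrow> ennreal"
  assumes [measurable]: "f \<in> borel_measurable borel"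
  shows "(\<integral>\<^sup>+(x, y, z). f (x, y) \<partial>coupling n) = (\<integral>\<^sup>+p. f p \<partial>unit_square)"
    and "(\<integral>\<^sup>+(x, y, z). f (x, z) \<partial>coupling n) = (\<integral>\<^sup>+p. f p \<partial>unit_square)"
    and "(\<integral>\<^sup>+(x, y, z). f (y, z) \<partial>coupling n) = (\<integral>\<^sup>+p. f p \<partial>unit_square)"
proof -
  let ?d = "coupling_density n"
  have triple: "(\<integral>\<^sup>+w. (case w of (x, y, z) \<Rightarrow> g x y z) \<partial>coupling n)
      = (\<integral>\<^sup>+x. \<integral>\<^sup>+y. \<integral>\<^sup>+z. ?d x y z * g x y z \<partial>lborel \<partial>lborel \<partial>lborel)"
    if [measurable]: "(\<lambda>(x, y, z). g x y z) \<in> borel_measurable borel" for g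
  proof -
    have [measurable]: "(\<lambda>(x, y, z). ?d x y z) \<in> borel_measurable borel"
      by (simp add: split_beta')
    have "(\<integral>\<^sup>+w. (case w of (x, y, z) \<Rightarrow> g x y z) \<partial>coupling n)
        = (\<integral>\<^sup>+w. (case w of (x, y, z) \<Rightarrow> ?d x y z) * (case w of (x, y, z) \<Rightarrow> g x y z) \<partial>lborel)"
      unfolding coupling_def by (subst nn_integral_density) auto
    then show ?thesis by (subst (asm) nn_integral_lborel_triple) auto
  qed
  have slice: "(\<integral>\<^sup>+z. ?d x y z * c \<partial>lborel) = c * indicator ({0..<1} \<times> {0..<1}) (x, y)" for x y c
    by (subst nn_integral_multc) (auto simp: nn_integral_coupling_density mult.commute)
  show "(\<integral>\<^sup>+(x, y, z). f (x, y) \<partial>coupling n) = (\<integral>\<^sup>+p. f p \<partial>unit_square)"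
    by (subst triple) (auto simp: slice nn_integral_unit_square split_beta')
  have "(\<integral>\<^sup>+(x, y, z). f (x, z) \<partial>coupling n)
      = (\<integral>\<^sup>+x. \<integral>\<^sup>+z. \<integral>\<^sup>+y. ?d x y z * f (x, z) \<partial>lborel \<partial>lborel \<partial>lborel)"
    by (subst triple) (auto simp: split_beta'
        intro!: nn_integral_cong nn_integral_swap_lborel[where h = "\<lambda>(y, z). ?d _ y z * f (_, z)", simplified])
  also have "\<dots> = (\<integral>\<^sup>+x. \<integral>\<^sup>+z. \<integral>\<^sup>+y. ?d x z y * f (x, z) \<partial>lborel \<partial>lborel \<partial>lborel)"
    by (simp only: coupling_density_permute(1))
  finally show "(\<integral>\<^sup>+(x, y, z). f (x, z) \<partial>coupling n) = (\<integral>\<^sup>+p. f p \<partial>unit_square)"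
    by (simp add: slice nn_integral_unit_square)
  have "(\<integral>\<^sup>+(x, y, z). f (y, z) \<partial>coupling n)
      = (\<integral>\<^sup>+y. \<integral>\<^sup>+x. \<integral>\<^sup>+z. ?d x y z * f (y, z) \<partial>lborel \<partial>lborel \<partial>lborel)"
    by (subst triple) (auto simp: split_beta'
        intro!: nn_integral_swap_lborel[where h = "\<lambda>(x, y). \<integral>\<^sup>+z. ?d x y z * f (y, z) \<partial>lborel", simplified])
  also have "\<dots> = (\<integral>\<^sup>+y. \<integral>\<^sup>+z. \<integral>\<^sup>+x. ?d x y z * f (y, z) \<partial>lborel \<partial>lborel \<partial>lborel)"
    by (auto simp: split_beta'
        intro!: nn_integral_cong nn_integral_swap_lborel[where h = "\<lambda>(x, z). ?d x _ z * f (_, z)", simplified])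
  also have "\<dots> = (\<integral>\<^sup>+y. \<integral>\<^sup>+z. \<integral>\<^sup>+x. ?d y z x * f (y, z) \<partial>lborel \<partial>lborel \<partial>lborel)"
    by (simp only: coupling_density_permute(2))
  finally show "(\<integral>\<^sup>+(x, y, z). f (y, z) \<partial>coupling n) = (\<integral>\<^sup>+p. f p \<partial>unit_square)"
    by (simp add: slice nn_integral_unit_square)
qed

text \<open>Testing the integral identities on indicator functions turns them into equality of
  measures, which transfers integrals of real functions and null sets as well.\<close>

lemma distr_coupling:
  "distr (coupling n) borel (\<lambda>(x, y, z). (x, y)) = unit_square"
  "distr (coupling n) borel (\<lambda>(x, y, z). (x, z)) = unit_square"
  "distr (coupling n) borel (\<lambda>(x, y, z). (y, z)) = unit_square"
proof -
  have *: "distr (coupling n) borel T = unit_square"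
    if [measurable]: "T \<in> borel_measurable borel"
      and eq: "\<And>f. f \<in> borel_measurable borel \<Longrightarrow> (\<integral>\<^sup>+w. f (T w) \<partial>coupling n) = (\<integral>\<^sup>+p. f p \<partial>unit_square)"
    for T :: "real \<times> real \<times> real \<Rightarrow> real \<times> real"
  proof (rule measure_eqI)
    show "sets (distr (coupling n) borel T) = sets unit_square" by (simp add: unit_square_def)
    fix A assume "A \<in> sets (distr (coupling n) borel T)"
    then have A [measurable]: "A \<in> sets borel" by simp
    have [measurable_cong]: "sets (coupling n) = sets borel" by (simp add: coupling_def)
    have "emeasure (distr (coupling n) borel T) A = (\<integral>\<^sup>+p. indicator A p \<partial>distr (coupling n) borel T)"
      by simp
    also have "\<dots> = (\<integral>\<^sup>+p. indicator A p \<partial>unit_square)"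
      by (subst nn_integral_distr) (auto simp: eq)
    also have "\<dots> = emeasure unit_square A"
      using A by (intro nn_integral_indicator) (simp add: unit_square_def)
    finally show "emeasure (distr (coupling n) borel T) A = emeasure unit_square A" .
  qed
  show "distr (coupling n) borel (\<lambda>(x, y, z). (x, y)) = unit_square"
    by (rule *) (auto simp: split_beta' nn_integral_coupling_marginals(1)[unfolded split_beta'])
  show "distr (coupling n) borel (\<lambda>(x, y, z). (x, z)) = unit_square"
    by (rule *) (auto simp: split_beta' nn_integral_coupling_marginals(2)[unfolded split_beta'])
  show "distr (coupling n) borel (\<lambda>(x, y, z). (y, z)) = unit_square"
    by (rule *) (use nn_integral_coupling_marginals(3) in \<open>auto simp: split_beta'\<close>)
qed

lemma emeasure_coupling: "emeasure (coupling n) (space (coupling n)) = 1"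
proof -
  have "emeasure (coupling n) (space (coupling n)) = (\<integral>\<^sup>+p. 1 \<partial>unit_square)"
    using nn_integral_coupling_marginals(1)[of "\<lambda>_. 1" n] by (simp add: split_beta')
  also have "\<dots> = (\<integral>\<^sup>+x. indicator {0..<1} x \<partial>(lborel :: real measure))"
    by (subst nn_integral_unit_square)
       (auto simp: indicator_times nn_integral_cmult intro!: nn_integral_cong)
  also have "\<dots> = 1" by simp
  finally show ?thesis .
qed

lemma finite_measure_coupling: "finite_measure (coupling n)"
  by (rule finite_measureI) (simp add: emeasure_coupling)

lemma AE_coupling:
  "AE (x, y, z) in coupling n. x \<in> {0..<1} \<and> y \<in> {0..<1} \<and> z \<in> {0..<1} \<and> xor_even n x y z"
proof -
  have "(\<lambda>(x, y, z). coupling_density n x y z) \<in> borel_measurable lborel"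
    by (simp add: split_beta')
  then show ?thesis
    unfolding coupling_def by (subst AE_density) (auto simp: coupling_density_def split: if_splits)
qed

section \<open>Lebesgue integrable functions evaluated along the couplings\<close>

lemma AE_lborel_square:
  "AE p :: real \<times> real in lborel. p \<in> {0..1} \<times> {0..1} \<longleftrightarrow> p \<in> {0..<1} \<times> {0..<1}"
proof -
  have ne: "AE x :: real in lborel. x \<noteq> 1" by (rule AE_lborel_singleton)
  have "AE p :: real \<times> real in lborel \<Otimes>\<^sub>M lborel. fst p \<noteq> 1 \<and> snd p \<noteq> 1"
  proof (rule lborel_pair.AE_pair_measure)
    show "{p \<in> space (lborel \<Otimes>\<^sub>M lborel). fst p \<noteq> 1 \<and> snd p \<noteq> 1}
        \<in> sets (lborel \<Otimes>\<^sub>M lborel :: (real \<times> real) measure)"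
      by measurable
    show "AE x in lborel. AE y in lborel. fst (x, y) \<noteq> (1::real) \<and> snd (x, y) \<noteq> (1::real)"
      using ne by eventually_elim (use ne in \<open>auto elim!: eventually_mono\<close>)
  qed
  then show ?thesis
    unfolding lborel_prod by eventually_elim auto
qed

text \<open>A competitor \<open>G\<close> is only Lebesgue measurable, while the couplings are
  measures on Borel sets. It is replaced by a Borel function equal to it almost everywhere on the
  square, which is harmless because \<open>unit_square\<close> is absolutely continuous.\<close>

lemma square_integral_unit_square:
  assumes int: "set_integrable lebesgue ({0..1} \<times> {0..1}) (\<lambda>(x, y). G x y)"
  obtains g :: "real \<times> real \<Rightarrow> real" where "g \<in> borel_measurable borel" "integrable unit_square g"
    "(\<integral>p. g p \<partial>unit_square) = (LINT (x, y):{0..1} \<times> {0..1}|lebesgue. G x y)"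
    "AE (x, y) in unit_square. g (x, y) = G x y"
proof -
  let ?S = "{0..1} \<times> {0..1} :: (real \<times> real) set"
  let ?H = "{0..<1} \<times> {0..<1} :: (real \<times> real) set"
  define g0 where "g0 p = indicator ?S p *\<^sub>R (case p of (x, y) \<Rightarrow> G x y)" for p
  have i0: "integrable lebesgue g0" using int unfolding set_integrable_def g0_def[abs_def] .
  obtain g where g [measurable]: "g \<in> borel_measurable borel" and ae: "AE p in lborel. g0 p = g p"
    using completion_ex_borel_measurable_real[OF borel_measurable_integrable[OF i0]] by auto
  have gl: "g \<in> borel_measurable lebesgue" using g by (intro measurable_completion) simp
  have ae': "AE p in lebesgue. g0 p = g p" using ae by (rule AE_completion)
  have il: "integrable lborel g"
    using integrable_cong_AE_imp[OF i0 gl ae'] g by (simp add: integrable_completion)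
  have eq: "integral\<^sup>L lborel g = (LINT (x, y):?S|lebesgue. G x y)"
    using integral_cong_AE[OF borel_measurable_integrable[OF i0] gl ae'] g
    by (simp add: integral_completion set_lebesgue_integral_def g0_def split_beta')
  have H [measurable]: "?H \<in> sets borel" by (simp flip: borel_prod)
  have us: "unit_square = density lborel (\<lambda>p. ennreal (indicator ?H p))"
    unfolding unit_square_def
    by (rule arg_cong[where f = "density lborel"]) (auto simp: fun_eq_iff indicator_def)
  \<comment> \<open>\<open>g\<close> vanishes almost everywhere off the closed square, because
    \<open>g0\<close> does, and the closed and half-open squares differ by a null set.\<close>
  have ind: "AE p in lborel. indicator ?H p *\<^sub>R g p = g p"
    using ae AE_lborel_square by eventually_elim (auto simp: g0_def indicator_def)
  have "integrable lborel (\<lambda>p. indicator ?H p *\<^sub>R g p)"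
    by (rule integrable_cong_AE_imp[OF il]) (use ind in \<open>auto elim: eventually_mono\<close>)
  then have "integrable unit_square g"
    unfolding us by (subst integrable_density) auto
  moreover have "integral\<^sup>L unit_square g = integral\<^sup>L lborel (\<lambda>p. indicator ?H p *\<^sub>R g p)"
    unfolding us by (subst integral_density) auto
  then have "integral\<^sup>L unit_square g = (LINT (x, y):?S|lebesgue. G x y)"
    using integral_cong_AE[OF _ _ ind] eq by simp
  moreover have "AE p in unit_square. g p = (case p of (x, y) \<Rightarrow> G x y)"
    unfolding us using ae
    by (subst AE_density) (auto simp: g0_def indicator_def elim!: eventually_mono split: if_splits)
  ultimately show thesis using that[OF g] by (simp add: split_beta')
qed

text \<open>Since all three projections of the coupling are uniform on the square, the integral of
  the sum is the sum of three square integrals, which is the objective. The function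
  \<open>k\<close> is built from a Borel version of \<open>G\<close>.\<close>

lemma coupling_integral:
  assumes "set_integrable lebesgue ({0..1} \<times> {0..1}) (\<lambda>(x, y). G x y)"
  obtains k where "integrable (coupling n) k" "integral\<^sup>L (coupling n) k = dual_objective G"
    "AE (x, y, z) in coupling n. k (x, y, z) = G x y + G x z + G y z"
proof -
  obtain g where g [measurable]: "g \<in> borel_measurable borel"
    and i: "integrable unit_square g"
    and eq: "integral\<^sup>L unit_square g = (LINT (x, y):{0..1} \<times> {0..1}|lebesgue. G x y)"
    and ae: "AE (x, y) in unit_square. g (x, y) = G x y"
    using square_integral_unit_square[OF assms] by blast
  have [measurable_cong]: "sets (coupling n) = sets borel" by (simp add: coupling_def)
  let ?p = "\<lambda>(x, y, z). (x, y) :: real \<times> real" and ?q = "\<lambda>(x, y, z). (x, z) :: real \<times> real"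
    and ?r = "\<lambda>(x, y, z). (y, z) :: real \<times> real"
  define k where "k w = g (?p w) + g (?q w) + g (?r w)" for w
  have "integrable (coupling n) (\<lambda>w. g (T w)) \<and> (\<integral>w. g (T w) \<partial>coupling n) = integral\<^sup>L unit_square g
      \<and> (AE w in coupling n. case T w of (x, y) \<Rightarrow> g (x, y) = G x y)"
    if T: "T \<in> {?p, ?q, ?r}" for T
  proof -
    have m [measurable]: "T \<in> borel_measurable (coupling n)" using T by (auto simp: split_beta')
    have d: "distr (coupling n) borel T = unit_square" using T distr_coupling by auto
    \<comment> \<open>Null sets of \<open>unit_square\<close> pull back along the projection to null
      sets of the coupling, so replacing \<open>G\<close> by \<open>g\<close> is invisible there
      too.\<close>
    show ?thesis
      using integrable_distr[OF m, of g] integral_distr[OF m g] AE_distrD[OF m] i ae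
      unfolding d by auto
  qed
  note T = this[of ?p] this[of ?q] this[of ?r]
  show thesis
  proof (rule that)
    show "integrable (coupling n) k" unfolding k_def using T by auto
    show "integral\<^sup>L (coupling n) k = dual_objective G"
      unfolding k_def dual_objective_def using T by (simp add: eq)
    have "AE w in coupling n. case ?p w of (x, y) \<Rightarrow> g (x, y) = G x y"
      "AE w in coupling n. case ?q w of (x, y) \<Rightarrow> g (x, y) = G x y"
      "AE w in coupling n. case ?r w of (x, y) \<Rightarrow> g (x, y) = G x y"
      using T by auto
    then show "AE (x, y, z) in coupling n. k (x, y, z) = G x y + G x z + G y z"
      by eventually_elim (auto simp: k_def)
  qed
qed

theorem theorem7p9:
  "dual_feasible xor_F \<and> (\<forall>G. dual_feasible G \<longrightarrow> dual_objective G \<le> dual_objective xor_F)"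
proof (intro conjI allI impI xor_F_feasible)
  fix G assume "dual_feasible G"
  then have G: "set_integrable lebesgue ({0..1} \<times> {0..1}) (\<lambda>(x, y). G x y)"
    "\<And>x y z. x \<in> {0..1} \<Longrightarrow> y \<in> {0..1} \<Longrightarrow> z \<in> {0..1} \<Longrightarrow> G x y + G x z + G y z \<le> x * y * z"
    unfolding dual_feasible_def by blast+
  have "dual_objective G \<le> dual_objective xor_F + 6 * (1/8) ^ n" for n
  proof -
    interpret finite_measure "coupling n" by (rule finite_measure_coupling)
    obtain k where k: "integrable (coupling n) k" "integral\<^sup>L (coupling n) k = dual_objective G"
      "AE (x, y, z) in coupling n. k (x, y, z) = G x y + G x z + G y z"
      using coupling_integral[OF G(1)] .
    obtain l where l: "integrable (coupling n) l" "integral\<^sup>L (coupling n) l = dual_objective xor_F"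
      "AE (x, y, z) in coupling n. l (x, y, z) = xor_F x y + xor_F x z + xor_F y z"
      using coupling_integral[OF xor_F_integrable] .
    \<comment> \<open>On the support the constraint bounds \<open>k\<close> by
      \<open>x * y * z\<close>, which is \<open>l\<close> plus the gap, and the gap is at most
      \<open>6 * (1/8) ^ n\<close> there. Since the coupling has mass 1, integration keeps this
      error term unchanged.\<close>
    have "AE w in coupling n. k w \<le> l w + 6 * (1/8) ^ n"
      using k(3) l(3) AE_coupling[of n]
    proof eventually_elim
      case (elim w)
      obtain x y z where w: "w = (x, y, z)" by (cases w)
      have u: "x \<in> {0..1}" "y \<in> {0..1}" "z \<in> {0..1}" using elim(3) w by auto
      have "xor_gap x y z \<le> 6 * (1/8) ^ n" using elim(3) w by (intro xor_gap_le_of_xor_even) auto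
      then show ?case using elim(1,2) w G(2)[OF u] xor_F_sum[OF u] by simp
    qed
    then have "integral\<^sup>L (coupling n) k \<le> (\<integral>w. l w + 6 * (1/8) ^ n \<partial>coupling n)"
      using k(1) l(1) by (intro integral_mono_AE) auto
    also have "\<dots> = integral\<^sup>L (coupling n) l + 6 * (1/8) ^ n"
      using l(1) by (simp add: measure_def emeasure_coupling)
    finally show ?thesis by (simp add: k(2) l(2))
  qed
  moreover have "(\<lambda>n. dual_objective xor_F + 6 * (1/8) ^ n) \<longlonglongrightarrow> dual_objective xor_F + 6 * 0"
    by (intro tendsto_intros LIMSEQ_power_zero) simp
  ultimately show "dual_objective G \<le> dual_objective xor_F"
    by (intro LIMSEQ_le_const[of "\<lambda>n. dual_objective xor_F + 6 * (1/8) ^ n"]) auto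
qed

end
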